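(* Let $(\mu_\circ,\eta_\circ,\delta_\circ,\epsilon_\circ)$ and $(\mu_\bullet,\eta_\bullet,\delta_\bullet,\epsilon_\bullet)$ form a GHZ/W-pair on an object $Q$ of a symmetric monoidal category $\mathbf V$, and assume $\{\eta_\bullet,\tau\circ\eta_\bullet\}$ is a plugging set for $Q$. Then for every $\psi:I\to Q$, $$\Phi_\psi\circ\eta_\bullet=(\epsilon_\bullet\circ\tau\circ\psi)\cdot\eta_\bullet,$$ where $\Phi_\psi:=\mu_\circ\circ(1_Q\otimes\psi)$.
   Context: Let $(\mathbf V,\otimes,I,\sigma)$ be a symmetric monoidal category; scalars are morphisms $I\to I$ and $s\cdot f$ denotes $s\otimes f$ with $I\otimes X\cong X$. A commutative Frobenius algebra (CFA) on $Q$ is a commutative monoid $(Q,\mu,\eta)$ and cocommutative comonoid $(Q,\delta,\epsilon)$ with $(1\otimes\mu)(\delta\otimes 1)=\delta\mu=(\mu\otimes1)(1\otimes\delta)$. It is special if $\mu\circ\delta=1_Q$, and anti-special if $c\cdot(\mu\circ\delta)=(\mu\circ\delta\circ\eta)\circ(\epsilon\circ\mu\circ\delta)$ where $c=\epsilon\circ\mu\circ\delta\circ\eta$. A GHZ-structure is a special CFA $(\mu_\circ,\eta_\circ,\delta_\circ,\epsilon_\circ)$, a W-structure an anti-special CFA $(\mu_\bullet,\eta_\bullet,\delta_\bullet,\epsilon_\bullet)$, both on $Q$. Define $\tau:=(\epsilon_\bullet\mu_\bullet\otimes 1_Q)\circ(1_Q\otimes\delta_\circ\eta_\circ):Q\to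 Q$. They form a GHZ/W-pair if: ($\alpha$) $\tau=(\epsilon_\circ\mu_\circ\otimes 1_Q)\circ(1_Q\otimes\delta_\bullet\eta_\bullet)$; ($\beta$) $\delta_\circ\circ\eta_\bullet=\eta_\bullet\otimes\eta_\bullet$; ($\gamma$) $\delta_\circ\circ\tau=(\tau\otimes\tau)\circ\delta_\circ$; ($\xi$) $(\epsilon_\bullet\mu_\bullet\delta_\bullet\eta_\bullet)\cdot(\tau\circ\eta_\bullet)=\mu_\bullet\circ\delta_\bullet\circ\eta_\bullet$. A set of points $\{\psi_i:I\to Q\}$ is a plugging set if for all objects $A$ and $f,g:Q\to A$, $f=g$ iff $f\circ\psi_i=g\circ\psi_i$ for all $i$. *)

theory Defs
  imports Main
begin

section \<open>Symmetric monoidal categories\<close>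

record ('o, 'm) category =
  obj :: "'o set"
  arr :: "'m set"
  src :: "'m \<Rightarrow> 'o"
  trg :: "'m \<Rightarrow> 'o"
  idn :: "'o \<Rightarrow> 'm"  (\<open>\<one>\<index>\<close>)
  comp :: "'m \<Rightarrow> 'm \<Rightarrow> 'm"  (infixr \<open>\<cdot>\<index>\<close> 65)

definition hom :: "('o, 'm, 'x) category_scheme \<Rightarrow> 'o \<Rightarrow> 'o \<Rightarrow> 'm set" where
  "hom C A B = {f \<in> arr C. src C f = A \<and> trg C f = B}"

locale category =
  fixes C (structure)
  assumes src_obj: "f \<in> arr C \<Longrightarrow> src C f \<in> obj C"
    and trg_obj: "f \<in> arr C \<Longrightarrow> trg C f \<in> obj C"
    and id_hom: "A \<in> obj C \<Longrightarrow> \<one> A \<in> hom C A A"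
    and comp_hom: "f \<in> hom C A B \<Longrightarrow> g \<in> hom C B D \<Longrightarrow> g \<cdot> f \<in> hom C A D"
    and comp_id_left: "f \<in> hom C A B \<Longrightarrow> \<one> B \<cdot> f = f"
    and comp_id_right: "f \<in> hom C A B \<Longrightarrow> f \<cdot> \<one> A = f"
    and comp_assoc: "f \<in> hom C A B \<Longrightarrow> g \<in> hom C B D \<Longrightarrow> h \<in> hom C D E \<Longrightarrow>
      (h \<cdot> g) \<cdot> f = h \<cdot> (g \<cdot> f)"

definition inverse_arrows :: "('o, 'm, 'x) category_scheme \<Rightarrow> 'm \<Rightarrow> 'm \<Rightarrow> bool" where
  "inverse_arrows C f g \<longleftrightarrow>
     f \<in> arr C \<and> g \<in> hom C (trg C f) (src C f) \<and>
     g \<cdot> f = \<one> (src C f) \<and> f \<cdot> g = \<one> (trg C f)" for C (structure)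

definition iso :: "('o, 'm, 'x) category_scheme \<Rightarrow> 'm \<Rightarrow> bool" where
  "iso C f \<longleftrightarrow> (\<exists>g. inverse_arrows C f g)"

definition inverse_arr :: "('o, 'm, 'x) category_scheme \<Rightarrow> 'm \<Rightarrow> 'm"
  (\<open>inv\<index> _\<close> [81] 80) where
  "inv\<^bsub>C\<^esub> f = (THE g. inverse_arrows C f g)"

record ('o, 'm) monoidal_category = "('o, 'm) category" +
  tensor_obj :: "'o \<Rightarrow> 'o \<Rightarrow> 'o"  (infixr \<open>\<odot>\<index>\<close> 70)
  tensor :: "'m \<Rightarrow> 'm \<Rightarrow> 'm"  (infixr \<open>\<otimes>\<index>\<close> 70)
  unit_obj :: 'o  (\<open>\<I>\<index>\<close>)
  assoc :: "'o \<Rightarrow> 'o \<Rightarrow> 'o \<Rightarrow> 'm"  (\<open>\<a>\<index>\<close>)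
  lunit :: "'o \<Rightarrow> 'm"  (\<open>\<l>\<index>\<close>)
  runit :: "'o \<Rightarrow> 'm"  (\<open>\<r>\<index>\<close>)

locale monoidal_category = category C for C (structure) +
  assumes unit_obj: "\<I> \<in> obj C"
    and tensor_obj: "A \<in> obj C \<Longrightarrow> B \<in> obj C \<Longrightarrow> A \<odot> B \<in> obj C"
    and tensor_hom: "f \<in> hom C A B \<Longrightarrow> g \<in> hom C A' B' \<Longrightarrow>
      f \<otimes> g \<in> hom C (A \<odot> A') (B \<odot> B')"
    and tensor_id: "A \<in> obj C \<Longrightarrow> B \<in> obj C \<Longrightarrow> \<one> A \<otimes> \<one> B = \<one> (A \<odot> B)"
    and tensor_comp: "f \<in> hom C A B \<Longrightarrow> g \<in> hom C B D \<Longrightarrow>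
      f' \<in> hom C A' B' \<Longrightarrow> g' \<in> hom C B' D' \<Longrightarrow>
      (g \<cdot> f) \<otimes> (g' \<cdot> f') = (g \<otimes> g') \<cdot> (f \<otimes> f')"
    and assoc_hom: "A \<in> obj C \<Longrightarrow> B \<in> obj C \<Longrightarrow> D \<in> obj C \<Longrightarrow>
      \<a> A B D \<in> hom C ((A \<odot> B) \<odot> D) (A \<odot> (B \<odot> D))"
    and assoc_iso: "A \<in> obj C \<Longrightarrow> B \<in> obj C \<Longrightarrow> D \<in> obj C \<Longrightarrow> iso C (\<a> A B D)"
    and assoc_natural: "f \<in> hom C A A' \<Longrightarrow> g \<in> hom C B B' \<Longrightarrow> h \<in> hom C D D' \<Longrightarrow>
      \<a> A' B' D' \<cdot> ((f \<otimes> g) \<otimes> h) = (f \<otimes> (g \<otimes> h)) \<cdot> \<a> A B D"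
    and lunit_hom: "A \<in> obj C \<Longrightarrow> \<l> A \<in> hom C (\<I> \<odot> A) A"
    and lunit_iso: "A \<in> obj C \<Longrightarrow> iso C (\<l> A)"
    and lunit_natural: "f \<in> hom C A B \<Longrightarrow> \<l> B \<cdot> (\<one> \<I> \<otimes> f) = f \<cdot> \<l> A"
    and runit_hom: "A \<in> obj C \<Longrightarrow> \<r> A \<in> hom C (A \<odot> \<I>) A"
    and runit_iso: "A \<in> obj C \<Longrightarrow> iso C (\<r> A)"
    and runit_natural: "f \<in> hom C A B \<Longrightarrow> \<r> B \<cdot> (f \<otimes> \<one> \<I>) = f \<cdot> \<r> A"
    and pentagon: "A \<in> obj C \<Longrightarrow> B \<in> obj C \<Longrightarrow> D \<in> obj C \<Longrightarrow> E \<in> obj C \<Longrightarrow>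
      (\<one> A \<otimes> \<a> B D E) \<cdot> \<a> A (B \<odot> D) E \<cdot> (\<a> A B D \<otimes> \<one> E) =
      \<a> A B (D \<odot> E) \<cdot> \<a> (A \<odot> B) D E"
    and triangle: "A \<in> obj C \<Longrightarrow> B \<in> obj C \<Longrightarrow>
      (\<one> A \<otimes> \<l> B) \<cdot> \<a> A \<I> B = \<r> A \<otimes> \<one> B"

record ('o, 'm) symmetric_monoidal_category = "('o, 'm) monoidal_category" +
  sym :: "'o \<Rightarrow> 'o \<Rightarrow> 'm"  (\<open>\<s>\<index>\<close>)

locale symmetric_monoidal_category = monoidal_category V for V (structure) +
  assumes sym_hom: "A \<in> obj V \<Longrightarrow> B \<in> obj V \<Longrightarrow> \<s> A B \<in> hom V (A \<odot> B) (B \<odot> A)"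
    and sym_natural: "f \<in> hom V A A' \<Longrightarrow> g \<in> hom V B B' \<Longrightarrow>
      \<s> A' B' \<cdot> (f \<otimes> g) = (g \<otimes> f) \<cdot> \<s> A B"
    and sym_inverse: "A \<in> obj V \<Longrightarrow> B \<in> obj V \<Longrightarrow> \<s> B A \<cdot> \<s> A B = \<one> (A \<odot> B)"
    and hexagon: "A \<in> obj V \<Longrightarrow> B \<in> obj V \<Longrightarrow> D \<in> obj V \<Longrightarrow>
      \<a> B D A \<cdot> \<s> A (B \<odot> D) \<cdot> \<a> A B D =
      (\<one> B \<otimes> \<s> A D) \<cdot> \<a> B A D \<cdot> (\<s> A B \<otimes> \<one> D)"

text \<open>The scalar multiple $s \cdot f$ is the composite
  $X \cong I \otimes X \to I \otimes Y \cong Y$.\<close>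

definition scale :: "('o, 'm, 'x) monoidal_category_scheme \<Rightarrow> 'm \<Rightarrow> 'm \<Rightarrow> 'm" where
  "scale V s f = \<l> (trg V f) \<cdot> (s \<otimes> f) \<cdot> inv (\<l> (src V f))" for V (structure)


section \<open>Commutative Frobenius algebras\<close>

record 'm frobenius =
  mu :: 'm
  eta :: 'm
  delta :: 'm
  eps :: 'm

locale commutative_monoid =
  fixes V (structure) and Q and \<mu> and \<eta>
  assumes mu_hom: "\<mu> \<in> hom V (Q \<odot> Q) Q"
    and eta_hom: "\<eta> \<in> hom V \<I> Q"
    and mu_assoc: "\<mu> \<cdot> (\<mu> \<otimes> \<one> Q) = \<mu> \<cdot> (\<one> Q \<otimes> \<mu>) \<cdot> \<a> Q Q Q"
    and mu_unit_left: "\<mu> \<cdot> (\<eta> \<otimes> \<one> Q) = \<l> Q"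
    and mu_unit_right: "\<mu> \<cdot> (\<one> Q \<otimes> \<eta>) = \<r> Q"
    and mu_comm: "\<mu> \<cdot> \<s> Q Q = \<mu>"

locale cocommutative_comonoid =
  fixes V (structure) and Q and \<delta> and \<epsilon>
  assumes delta_hom: "\<delta> \<in> hom V Q (Q \<odot> Q)"
    and eps_hom: "\<epsilon> \<in> hom V Q \<I>"
    and delta_coassoc: "\<a> Q Q Q \<cdot> (\<delta> \<otimes> \<one> Q) \<cdot> \<delta> = (\<one> Q \<otimes> \<delta>) \<cdot> \<delta>"
    and delta_counit_left: "\<l> Q \<cdot> (\<epsilon> \<otimes> \<one> Q) \<cdot> \<delta> = \<one> Q"
    and delta_counit_right: "\<r> Q \<cdot> (\<one> Q \<otimes> \<epsilon>) \<cdot> \<delta> = \<one> Q"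
    and delta_cocomm: "\<s> Q Q \<cdot> \<delta> = \<delta>"

locale cfa =
  fixes V (structure) and Q and F
  assumes obj: "Q \<in> obj V"
    and monoid: "commutative_monoid V Q (mu F) (eta F)"
    and comonoid: "cocommutative_comonoid V Q (delta F) (eps F)"
    and frobenius_left:
      "(\<one> Q \<otimes> mu F) \<cdot> \<a> Q Q Q \<cdot> (delta F \<otimes> \<one> Q) = delta F \<cdot> mu F"
    and frobenius_right:
      "delta F \<cdot> mu F = (mu F \<otimes> \<one> Q) \<cdot> inv (\<a> Q Q Q) \<cdot> (\<one> Q \<otimes> delta F)"

locale ghz_structure = cfa V Q F for V (structure) and Q and F +
  assumes special: "mu F \<cdot> delta F = \<one> Q"

locale w_structure = cfa V Q F for V (structure) and Q and F +
  assumes anti_special: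
    "scale V (eps F \<cdot> mu F \<cdot> delta F \<cdot> eta F) (mu F \<cdot> delta F) =
     (mu F \<cdot> delta F \<cdot> eta F) \<cdot> (eps F \<cdot> mu F \<cdot> delta F)"


section \<open>GHZ/W-pairs\<close>

text \<open>For $c : Q \otimes Q \to I$ and $d : I \to Q \otimes Q$, the map
  $(c \otimes 1_Q) \circ (1_Q \otimes d) : Q \to Q$ with its coherence isomorphisms.\<close>

definition bend :: "('o, 'm, 'x) monoidal_category_scheme \<Rightarrow> 'o \<Rightarrow> 'm \<Rightarrow> 'm \<Rightarrow> 'm" where
  "bend V Q c d =
     \<l> Q \<cdot> (c \<otimes> \<one> Q) \<cdot> inv (\<a> Q Q Q) \<cdot> (\<one> Q \<otimes> d) \<cdot> inv (\<r> Q)" for V (structure)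

definition tau ::
  "('o, 'm, 'x) monoidal_category_scheme \<Rightarrow> 'o \<Rightarrow> 'm frobenius \<Rightarrow> 'm frobenius \<Rightarrow> 'm" where
  "tau V Q G W = bend V Q (eps W \<cdot> mu W) (delta G \<cdot> eta G)" for V (structure)

locale ghz_w_pair =
  fixes V (structure) and Q and G and W
  assumes ghz: "ghz_structure V Q G"
    and w: "w_structure V Q W"
    and \<alpha>: "tau V Q G W = bend V Q (eps G \<cdot> mu G) (delta W \<cdot> eta W)"
    and \<beta>: "delta G \<cdot> eta W = (eta W \<otimes> eta W) \<cdot> inv (\<l> \<I>)"
    and \<gamma>: "delta G \<cdot> tau V Q G W = (tau V Q G W \<otimes> tau V Q G W) \<cdot> delta G"
    and \<xi>: "scale V (eps W \<cdot> mu W \<cdot> delta W \<cdot> eta W) (tau V Q G W \<cdot> eta W) =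
      mu W \<cdot> delta W \<cdot> eta W"

definition plugging_set ::
  "('o, 'm, 'x) monoidal_category_scheme \<Rightarrow> 'o \<Rightarrow> 'm set \<Rightarrow> bool" where
  "plugging_set V Q P \<longleftrightarrow>
     P \<subseteq> hom V \<I> Q \<and>
     (\<forall>A \<in> obj V. \<forall>f \<in> hom V Q A. \<forall>g \<in> hom V Q A.
        f = g \<longleftrightarrow> (\<forall>p \<in> P. f \<cdot> p = g \<cdot> p))" for V (structure)

definition Phi ::
  "('o, 'm, 'x) monoidal_category_scheme \<Rightarrow> 'o \<Rightarrow> 'm frobenius \<Rightarrow> 'm \<Rightarrow> 'm" where
  "Phi V Q G \<psi> = mu G \<cdot> (\<one> Q \<otimes> \<psi>) \<cdot> inv (\<r> Q)" for V (structure)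

end

theory Submission
  imports Defs
begin

text \<open>
  Write \<open>e\<close> for the unit of the W-structure. By (\<open>\<beta>\<close>) it is copied by the GHZ-structure, so the
  Frobenius law gives \<open>\<delta> (\<mu> (\<psi> \<otimes> e)) = \<mu> (\<psi> \<otimes> e) \<otimes> e\<close>, and discarding the first factor yields
  \<open>\<mu> (\<psi> \<otimes> e) = \<epsilon> (\<mu> (\<psi> \<otimes> e)) \<cdot> e\<close>, with all operations those of the GHZ-structure. By (\<open>\<alpha>\<close>),
  \<open>\<tau>\<close> is the GHZ cap bent by the W cup, whose free leg becomes \<open>e\<close> under the W counit; hence the
  scalar is the W counit of \<open>\<tau> \<psi>\<close>. The rest is coherence for the unitors and the symmetry.
\<close>

section \<open>Inverses and cancellation in a category\<close>

context category
begin

text \<open>Typing is restated through \<open>arr\<close>, \<open>src\<close> and \<open>trg\<close>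
  because membership in \<open>hom\<close> leaves objects to be guessed, whereas these equations let
  the simplifier discharge side conditions by computation.\<close>

lemma arr_id [simp]:
  assumes "A \<in> obj C"
  shows "\<one> A \<in> arr C" "src C (\<one> A) = A" "trg C (\<one> A) = A"
  using id_hom[OF assms] by (auto simp: hom_def)

lemma src_trg_obj [simp]:
  assumes "f \<in> arr C"
  shows "src C f \<in> obj C" "trg C f \<in> obj C"
  using assms src_obj trg_obj by auto

lemma arr_comp [simp]:
  assumes "f \<in> arr C" "g \<in> arr C" "src C g = trg C f"
  shows "g \<cdot> f \<in> arr C" "src C (g \<cdot> f) = src C f" "trg C (g \<cdot> f) = trg C g"
  using comp_hom[of f "src C f" "trg C f" g "trg C g"] assms by (auto simp: hom_def)

lemma id_comp [simp]: "f \<in> arr C \<Longrightarrow> trg C f = A \<Longrightarrow> \<one> A \<cdot> f = f"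
  using comp_id_left[of f "src C f" A] by (auto simp: hom_def)

lemma comp_id [simp]: "f \<in> arr C \<Longrightarrow> src C f = A \<Longrightarrow> f \<cdot> \<one> A = f"
  using comp_id_right[of f A "trg C f"] by (auto simp: hom_def)

lemma assoc_comp [simp]:
  "f \<in> arr C \<Longrightarrow> g \<in> arr C \<Longrightarrow> h \<in> arr C \<Longrightarrow> src C g = trg C f \<Longrightarrow> src C h = trg C g \<Longrightarrow>
    (h \<cdot> g) \<cdot> f = h \<cdot> (g \<cdot> f)"
  using comp_assoc[of f "src C f" "trg C f" g "trg C g" h "trg C h"] by (auto simp: hom_def)

text \<open>Since \<open>inv\<close> is a definite description, it has a meaning only once inverses
  are unique; any \<open>h\<close> inverse to \<open>f\<close> equals \<open>h\<close> after
  \<open>f\<close> after \<open>g\<close>, hence \<open>g\<close>.\<close>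

lemma inverse_arrows_inv:
  assumes "iso C f"
  shows "inverse_arrows C f (inv f)"
proof -
  obtain g where g: "inverse_arrows C f g"
    using assms by (auto simp: iso_def)
  have "h = g" if h: "inverse_arrows C f h" for h
  proof -
    have "h = h \<cdot> (f \<cdot> g)" using g h by (auto simp: inverse_arrows_def hom_def)
    also have "\<dots> = (h \<cdot> f) \<cdot> g"
      by (rule assoc_comp[symmetric]) (use g h in \<open>auto simp: inverse_arrows_def hom_def\<close>)
    also have "\<dots> = g" using g h by (auto simp: inverse_arrows_def hom_def)
    finally show ?thesis .
  qed
  then show ?thesis
    unfolding inverse_arr_def using g by (metis theI)
qed

lemma arr_inv [simp]:
  assumes "iso C f"
  shows "inv f \<in> arr C" "src C (inv f) = trg C f" "trg C (inv f) = src C f"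
    "inv f \<cdot> f = \<one> (src C f)" "f \<cdot> inv f = \<one> (trg C f)"
  using inverse_arrows_inv[OF assms] by (auto simp: inverse_arrows_def hom_def)

lemma iso_arr: "iso C f \<Longrightarrow> f \<in> arr C"
  by (auto simp: iso_def inverse_arrows_def)

lemma iso_cancel_left:
  assumes "iso C h" "f \<in> arr C" "g \<in> arr C" "trg C f = src C h" "trg C g = src C h"
    and "h \<cdot> f = h \<cdot> g"
  shows "f = g"
proof -
  have "inv h \<cdot> (h \<cdot> f) = inv h \<cdot> (h \<cdot> g)" using assms(6) by simp
  then show ?thesis
    using assms(1-5) iso_arr[OF assms(1)] by (simp flip: assoc_comp)
qed

lemma iso_cancel_right:
  assumes "iso C h" "f \<in> arr C" "g \<in> arr C" "src C f = trg C h" "src C g = trg C h"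
    and "f \<cdot> h = g \<cdot> h"
  shows "f = g"
proof -
  have "(f \<cdot> h) \<cdot> inv h = (g \<cdot> h) \<cdot> inv h" using assms(6) by simp
  then show ?thesis
    using assms(1-5) iso_arr[OF assms(1)] by simp
qed

text \<open>Simplification nests composites to the right, so an equation for \<open>g\<close> after
  \<open>f\<close> no longer matches inside a longer chain. The tail \<open>k\<close> restores the
  match.\<close>

lemma comp_reassoc:
  assumes "g \<cdot> f = h" "f \<in> arr C" "g \<in> arr C" "src C g = trg C f" "k \<in> arr C" "trg C k = src C f"
  shows "g \<cdot> (f \<cdot> k) = h \<cdot> k"
  using assms by (simp flip: assoc_comp)

lemma iso_inv_cancel [simp]:
  assumes "iso C f" "k \<in> arr C"
  shows "trg C k = src C f \<Longrightarrow> inv f \<cdot> (f \<cdot> k) = k"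
    and "trg C k = trg C f \<Longrightarrow> f \<cdot> (inv f \<cdot> k) = k"
  using assms iso_arr[OF assms(1)] by (simp_all flip: assoc_comp)

text \<open>Turns a commuting square around along its two invertible sides; it supplies naturality
  of the inverse associator and inverse right unitor.\<close>

lemma comp_inv_natural:
  assumes "iso C h" "iso C k" "f \<in> arr C" "g \<in> arr C"
    and "src C f = src C k" "trg C f = src C h" "src C g = trg C k" "trg C g = trg C h"
    and "h \<cdot> f = g \<cdot> k"
  shows "inv h \<cdot> g = f \<cdot> inv k"
proof -
  have "inv h \<cdot> g = inv h \<cdot> (g \<cdot> k) \<cdot> inv k"
    using assms iso_arr[OF assms(1)] iso_arr[OF assms(2)] by simp
  also have "\<dots> = inv h \<cdot> (h \<cdot> f) \<cdot> inv k" using assms by simp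
  also have "\<dots> = f \<cdot> inv k"
    using assms(1-8) iso_arr[OF assms(1)] iso_arr[OF assms(2)] by simp
  finally show ?thesis .
qed

end

section \<open>Naturality and unit coherence in a monoidal category\<close>

context monoidal_category
begin

declare unit_obj [simp] tensor_obj [simp] assoc_iso [simp] lunit_iso [simp] runit_iso [simp]

lemma arr_tensor [simp]:
  assumes "f \<in> arr C" "g \<in> arr C"
  shows "f \<otimes> g \<in> arr C" "src C (f \<otimes> g) = src C f \<odot> src C g"
    "trg C (f \<otimes> g) = trg C f \<odot> trg C g"
  using tensor_hom[of f "src C f" "trg C f" g "src C g" "trg C g"] assms by (auto simp: hom_def)

lemma arr_assoc [simp]:
  assumes "A \<in> obj C" "B \<in> obj C" "D \<in> obj C"
  shows "\<a> A B D \<in> arr C" "src C (\<a> A B D) = (A \<odot> B) \<odot> D" "trg C (\<a> A B D) = A \<odot> (B \<odot> D)"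
  using assoc_hom[OF assms] by (auto simp: hom_def)

lemma arr_unitors [simp]:
  assumes "A \<in> obj C"
  shows "\<l> A \<in> arr C" "src C (\<l> A) = \<I> \<odot> A" "trg C (\<l> A) = A"
    "\<r> A \<in> arr C" "src C (\<r> A) = A \<odot> \<I>" "trg C (\<r> A) = A"
  using lunit_hom[OF assms] runit_hom[OF assms] by (auto simp: hom_def)

lemma tensor_id' [simp]: "A \<in> obj C \<Longrightarrow> B \<in> obj C \<Longrightarrow> \<one> A \<otimes> \<one> B = \<one> (A \<odot> B)"
  by (rule tensor_id)

lemma interchange [simp]:
  assumes "f \<in> arr C" "g \<in> arr C" "f' \<in> arr C" "g' \<in> arr C"
    and "src C g = trg C f" "src C g' = trg C f'"
  shows "(g \<otimes> g') \<cdot> (f \<otimes> f') = (g \<cdot> f) \<otimes> (g' \<cdot> f')"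
  using tensor_comp[of f "src C f" "trg C f" g "trg C g" f' "src C f'" "trg C f'" g' "trg C g'"] assms
  by (auto simp: hom_def)

lemma interchange_reassoc [simp]:
  assumes "f \<in> arr C" "g \<in> arr C" "f' \<in> arr C" "g' \<in> arr C" "k \<in> arr C"
    and "src C g = trg C f" "src C g' = trg C f'" "trg C k = src C f \<odot> src C f'"
  shows "(g \<otimes> g') \<cdot> (f \<otimes> f') \<cdot> k = ((g \<cdot> f) \<otimes> (g' \<cdot> f')) \<cdot> k"
  using assms by (simp flip: assoc_comp)

lemma assoc_nat:
  "f \<in> arr C \<Longrightarrow> g \<in> arr C \<Longrightarrow> h \<in> arr C \<Longrightarrow> trg C f = A \<Longrightarrow> trg C g = B \<Longrightarrow> trg C h = D \<Longrightarrow>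
    \<a> A B D \<cdot> ((f \<otimes> g) \<otimes> h) = (f \<otimes> (g \<otimes> h)) \<cdot> \<a> (src C f) (src C g) (src C h)"
  using assoc_natural[of f "src C f" A g "src C g" B h "src C h" D] by (auto simp: hom_def)

lemma assoc_inv_nat:
  "f \<in> arr C \<Longrightarrow> g \<in> arr C \<Longrightarrow> h \<in> arr C \<Longrightarrow> trg C f = A \<Longrightarrow> trg C g = B \<Longrightarrow> trg C h = D \<Longrightarrow>
    inv (\<a> A B D) \<cdot> (f \<otimes> (g \<otimes> h)) = ((f \<otimes> g) \<otimes> h) \<cdot> inv (\<a> (src C f) (src C g) (src C h))"
  by (rule comp_inv_natural) (auto simp: assoc_nat)

lemma lunit_nat: "f \<in> arr C \<Longrightarrow> trg C f = A \<Longrightarrow> \<l> A \<cdot> (\<one> \<I> \<otimes> f) = f \<cdot> \<l> (src C f)"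
  using lunit_natural[of f "src C f" A] by (auto simp: hom_def)

lemma runit_nat: "f \<in> arr C \<Longrightarrow> trg C f = A \<Longrightarrow> \<r> A \<cdot> (f \<otimes> \<one> \<I>) = f \<cdot> \<r> (src C f)"
  using runit_natural[of f "src C f" A] by (auto simp: hom_def)

lemma runit_inv_nat:
  "f \<in> arr C \<Longrightarrow> trg C f = A \<Longrightarrow> inv (\<r> A) \<cdot> f = (f \<otimes> \<one> \<I>) \<cdot> inv (\<r> (src C f))"
  by (rule comp_inv_natural) (auto simp: runit_nat)

text \<open>The left unitor makes tensoring with the unit object naturally isomorphic to the
  identity functor. Coherence equations may thus be checked with an extra unit factor, where
  pentagon and triangle apply.\<close>

lemma unit_tensor_faithful:
  assumes "\<one> \<I> \<otimes> f = \<one> \<I> \<otimes> g" "f \<in> arr C" "g \<in> arr C" "src C f = src C g" "trg C f = trg C g"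
  shows "f = g"
proof (rule iso_cancel_right)
  show "f \<cdot> \<l> (src C f) = g \<cdot> \<l> (src C f)"
    using assms lunit_nat[of f "trg C f"] lunit_nat[of g "trg C g"] by simp
qed (use assms in auto)

lemma tensor_unit_faithful:
  assumes "f \<otimes> \<one> \<I> = g \<otimes> \<one> \<I>" "f \<in> arr C" "g \<in> arr C" "src C f = src C g" "trg C f = trg C g"
  shows "f = g"
proof (rule iso_cancel_right)
  show "f \<cdot> \<r> (src C f) = g \<cdot> \<r> (src C f)"
    using assms runit_nat[of f "trg C f"] runit_nat[of g "trg C g"] by simp
qed (use assms in auto)

lemma iso_tensor_id:
  assumes "iso C f" "A \<in> obj C"
  shows "iso C (f \<otimes> \<one> A)"
  unfolding iso_def
proof
  show "inverse_arrows C (f \<otimes> \<one> A) (inv f \<otimes> \<one> A)"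
    using assms iso_arr[OF assms(1)] by (auto simp: inverse_arrows_def hom_def)
qed

text \<open>Kelly's derivation of the left unit coherence from the pentagon and the triangle.\<close>

lemma lunit_tensor:
  assumes [simp]: "A \<in> obj C" "B \<in> obj C"
  shows "\<l> (A \<odot> B) \<cdot> \<a> \<I> A B = \<l> A \<otimes> \<one> B"
proof (rule unit_tensor_faithful)
  let ?k = "\<a> \<I> \<I> A \<otimes> \<one> B"
  show "\<one> \<I> \<otimes> (\<l> (A \<odot> B) \<cdot> \<a> \<I> A B) = \<one> \<I> \<otimes> (\<l> A \<otimes> \<one> B)"
  \<comment> \<open>Precomposing with this associator and then with \<open>?k\<close> completes one
    side of the pentagon at (I, I, A, B); both are isomorphisms and can be cancelled.\<close>
  proof (rule iso_cancel_right[where h = "\<a> \<I> (\<I> \<odot> A) B"], simp_all)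
    show "(\<one> \<I> \<otimes> (\<l> (A \<odot> B) \<cdot> \<a> \<I> A B)) \<cdot> \<a> \<I> (\<I> \<odot> A) B =
      (\<one> \<I> \<otimes> (\<l> A \<otimes> \<one> B)) \<cdot> \<a> \<I> (\<I> \<odot> A) B"
    proof (rule iso_cancel_right[where h = ?k])
      have "(\<one> \<I> \<otimes> (\<l> (A \<odot> B) \<cdot> \<a> \<I> A B)) \<cdot> \<a> \<I> (\<I> \<odot> A) B \<cdot> ?k =
        (\<one> \<I> \<otimes> \<l> (A \<odot> B)) \<cdot> (\<one> \<I> \<otimes> \<a> \<I> A B) \<cdot> \<a> \<I> (\<I> \<odot> A) B \<cdot> ?k"
        by simp
      also have "\<dots> = (\<one> \<I> \<otimes> \<l> (A \<odot> B)) \<cdot> \<a> \<I> \<I> (A \<odot> B) \<cdot> \<a> (\<I> \<odot> \<I>) A B"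
        by (simp only: pentagon unit_obj assms)
      also have "\<dots> = (\<r> \<I> \<otimes> (\<one> A \<otimes> \<one> B)) \<cdot> \<a> (\<I> \<odot> \<I>) A B"
        using comp_reassoc[OF triangle[of \<I> "A \<odot> B"], of "\<a> (\<I> \<odot> \<I>) A B"] by simp
      also have "\<dots> = \<a> \<I> A B \<cdot> ((\<r> \<I> \<otimes> \<one> A) \<otimes> \<one> B)"
        using assoc_nat[of "\<r> \<I>" "\<one> A" "\<one> B"] by simp
      also have "\<dots> = \<a> \<I> A B \<cdot> ((\<one> \<I> \<otimes> \<l> A) \<otimes> \<one> B) \<cdot> ?k"
        by (simp add: triangle)
      also have "\<dots> = (\<one> \<I> \<otimes> (\<l> A \<otimes> \<one> B)) \<cdot> \<a> \<I> (\<I> \<odot> A) B \<cdot> ?k"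
        using comp_reassoc[OF assoc_nat[of "\<one> \<I>" "\<l> A" "\<one> B" \<I> A B], of ?k] by simp
      finally show "((\<one> \<I> \<otimes> (\<l> (A \<odot> B) \<cdot> \<a> \<I> A B)) \<cdot> \<a> \<I> (\<I> \<odot> A) B) \<cdot> ?k =
        ((\<one> \<I> \<otimes> (\<l> A \<otimes> \<one> B)) \<cdot> \<a> \<I> (\<I> \<odot> A) B) \<cdot> ?k"
        by simp
    qed (simp_all add: iso_tensor_id)
  qed
qed simp_all

lemma lunit_unit_eq_runit_unit: "\<l> \<I> = \<r> \<I>"
proof (rule tensor_unit_faithful)
  \<comment> \<open>Naturality of the left unitor at the arrow \<open>\<l> \<I>\<close> itself, with
    \<open>\<l> \<I>\<close> cancelled. Afterwards \<open>lunit_tensor\<close> and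
    \<open>triangle\<close> have the same left-hand side.\<close>
  have "\<l> (\<I> \<odot> \<I>) = \<one> \<I> \<otimes> \<l> \<I>"
    by (rule iso_cancel_left[where h = "\<l> \<I>"]) (simp_all add: lunit_nat)
  then show "\<l> \<I> \<otimes> \<one> \<I> = \<r> \<I> \<otimes> \<one> \<I>"
    using lunit_tensor[of \<I> \<I>] triangle[of \<I> \<I>] by simp
qed simp_all

text \<open>The triangle with both sides inverted. It absorbs the unit factor created when one point
  on the right is replaced by two.\<close>

lemma triangle_inv:
  assumes [simp]: "A \<in> obj C" "B \<in> obj C"
  shows "inv (\<a> A \<I> B) \<cdot> (\<one> A \<otimes> inv (\<l> B)) = inv (\<r> A) \<otimes> \<one> B"
proof (rule iso_cancel_left[where h = "\<r> A \<otimes> \<one> B"])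
  have "(\<r> A \<otimes> \<one> B) \<cdot> inv (\<a> A \<I> B) \<cdot> (\<one> A \<otimes> inv (\<l> B)) =
    ((\<one> A \<otimes> \<l> B) \<cdot> \<a> A \<I> B) \<cdot> inv (\<a> A \<I> B) \<cdot> (\<one> A \<otimes> inv (\<l> B))"
    by (simp only: triangle assms)
  also have "\<dots> = (\<r> A \<otimes> \<one> B) \<cdot> (inv (\<r> A) \<otimes> \<one> B)" by simp
  finally show "(\<r> A \<otimes> \<one> B) \<cdot> inv (\<a> A \<I> B) \<cdot> (\<one> A \<otimes> inv (\<l> B)) =
    (\<r> A \<otimes> \<one> B) \<cdot> (inv (\<r> A) \<otimes> \<one> B)" .
qed (simp_all add: iso_tensor_id)

end

section \<open>Symmetry and unitors, then points of Frobenius algebras\<close>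

context symmetric_monoidal_category
begin

lemma arr_sym [simp]:
  assumes "A \<in> obj V" "B \<in> obj V"
  shows "\<s> A B \<in> arr V" "src V (\<s> A B) = A \<odot> B" "trg V (\<s> A B) = B \<odot> A"
  using sym_hom[OF assms] by (auto simp: hom_def)

lemma iso_sym [simp]: "A \<in> obj V \<Longrightarrow> B \<in> obj V \<Longrightarrow> iso V (\<s> A B)"
  unfolding iso_def
  by (rule exI[of _ "\<s> B A"]) (auto simp: inverse_arrows_def hom_def sym_inverse)

lemma sym_nat:
  "f \<in> arr V \<Longrightarrow> g \<in> arr V \<Longrightarrow> trg V f = A \<Longrightarrow> trg V g = B \<Longrightarrow>
    \<s> A B \<cdot> (f \<otimes> g) = (g \<otimes> f) \<cdot> \<s> (src V f) (src V g)"
  using sym_natural[of f "src V f" A g "src V g" B] by (auto simp: hom_def)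

text \<open>The hexagon at \<open>(A, I, I)\<close>, with the left unitor applied to its codomain.\<close>

lemma lunit_sym:
  assumes [simp]: "A \<in> obj V"
  shows "\<l> A \<cdot> \<s> A \<I> = \<r> A"
proof (rule tensor_unit_faithful)
  \<comment> \<open>The leading symmetry is there to be moved across \<open>\<l> \<I>\<close> by
    naturality, which exposes the hexagon. Naturality of the left unitor then brings it back to the
    front, where it cancels.\<close>
  have "\<s> A \<I> \<cdot> (\<r> A \<otimes> \<one> \<I>) = \<s> A \<I> \<cdot> (\<one> A \<otimes> \<l> \<I>) \<cdot> \<a> A \<I> \<I>"
    by (simp add: triangle)
  also have "\<dots> = (\<l> \<I> \<otimes> \<one> A) \<cdot> \<s> A (\<I> \<odot> \<I>) \<cdot> \<a> A \<I> \<I>"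
    using comp_reassoc[OF sym_nat[of "\<one> A" "\<l> \<I>" A \<I>], of "\<a> A \<I> \<I>"] by simp
  also have "\<dots> = \<l> (\<I> \<odot> A) \<cdot> \<a> \<I> \<I> A \<cdot> \<s> A (\<I> \<odot> \<I>) \<cdot> \<a> A \<I> \<I>"
    using comp_reassoc[OF lunit_tensor[of \<I> A], of "\<s> A (\<I> \<odot> \<I>) \<cdot> \<a> A \<I> \<I>"] by simp
  also have "\<dots> = \<l> (\<I> \<odot> A) \<cdot> (\<one> \<I> \<otimes> \<s> A \<I>) \<cdot> \<a> \<I> A \<I> \<cdot> (\<s> A \<I> \<otimes> \<one> \<I>)"
    by (simp add: hexagon)
  also have "\<dots> = \<s> A \<I> \<cdot> \<l> (A \<odot> \<I>) \<cdot> \<a> \<I> A \<I> \<cdot> (\<s> A \<I> \<otimes> \<one> \<I>)"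
    using comp_reassoc[OF lunit_nat[of "\<s> A \<I>" "\<I> \<odot> A"], of "\<a> \<I> A \<I> \<cdot> (\<s> A \<I> \<otimes> \<one> \<I>)"] by simp
  also have "\<dots> = \<s> A \<I> \<cdot> ((\<l> A \<cdot> \<s> A \<I>) \<otimes> \<one> \<I>)"
    using comp_reassoc[OF lunit_tensor[of A \<I>], of "\<s> A \<I> \<otimes> \<one> \<I>"] by simp
  finally have eq: "\<s> A \<I> \<cdot> (\<r> A \<otimes> \<one> \<I>) = \<s> A \<I> \<cdot> ((\<l> A \<cdot> \<s> A \<I>) \<otimes> \<one> \<I>)" .
  show "(\<l> A \<cdot> \<s> A \<I>) \<otimes> \<one> \<I> = \<r> A \<otimes> \<one> \<I>"
    by (rule iso_cancel_left[OF _ _ _ _ _ eq[symmetric]]) simp_all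
qed simp_all

lemma sym_runit_inv:
  assumes [simp]: "A \<in> obj V"
  shows "\<s> A \<I> \<cdot> inv (\<r> A) = inv (\<l> A)"
  by (rule iso_cancel_left[where h = "\<l> A"])
    (simp_all add: comp_reassoc[OF lunit_sym])

text \<open>Both sides start at the tensor square of the unit object: in the result its first factor
  feeds the scalar and its second feeds the surviving copy of \<open>e\<close>.\<close>

lemma copyable_mult:
  assumes F: "cfa V Q F"
    and e: "e \<in> hom V \<I> Q" and copy: "delta F \<cdot> e = (e \<otimes> e) \<cdot> inv (\<l> \<I>)"
    and p: "\<psi> \<in> hom V \<I> Q"
  shows "mu F \<cdot> (\<psi> \<otimes> e) = \<l> Q \<cdot> ((eps F \<cdot> mu F \<cdot> (\<psi> \<otimes> e) \<cdot> inv (\<r> \<I>)) \<otimes> e)"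
proof -
  interpret F: cfa V Q F by (rule F)
  interpret M: commutative_monoid V Q "mu F" "eta F" by (rule F.monoid)
  interpret D: cocommutative_comonoid V Q "delta F" "eps F" by (rule F.comonoid)
  note [simp] = F.obj
  have [simp]: "mu F \<in> arr V" "src V (mu F) = Q \<odot> Q" "trg V (mu F) = Q"
      "delta F \<in> arr V" "src V (delta F) = Q" "trg V (delta F) = Q \<odot> Q"
      "eps F \<in> arr V" "src V (eps F) = Q" "trg V (eps F) = \<I>"
      "e \<in> arr V" "src V e = \<I>" "trg V e = Q" "\<psi> \<in> arr V" "src V \<psi> = \<I>" "trg V \<psi> = Q"
    using M.mu_hom D.delta_hom D.eps_hom e p by (auto simp: hom_def)
  let ?y = "mu F \<cdot> (\<psi> \<otimes> e)"
  \<comment> \<open>This form of the Frobenius law makes the comultiplication act on the right leg,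
    which carries the copyable point.\<close>
  have "delta F \<cdot> ?y = (mu F \<otimes> \<one> Q) \<cdot> inv (\<a> Q Q Q) \<cdot> (\<psi> \<otimes> (delta F \<cdot> e))"
    using comp_reassoc[OF F.frobenius_right, of "\<psi> \<otimes> e"] by simp
  also have "\<dots> = (mu F \<otimes> \<one> Q) \<cdot> (inv (\<a> Q Q Q) \<cdot> (\<psi> \<otimes> (e \<otimes> e))) \<cdot> (\<one> \<I> \<otimes> inv (\<l> \<I>))"
    by (simp add: copy)
  also have "\<dots> = (mu F \<otimes> \<one> Q) \<cdot> ((\<psi> \<otimes> e) \<otimes> e) \<cdot> inv (\<a> \<I> \<I> \<I>) \<cdot> (\<one> \<I> \<otimes> inv (\<l> \<I>))"
    by (simp add: assoc_inv_nat)
  \<comment> \<open>By \<open>triangle_inv\<close> the remaining coherence becomes an inverse right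
    unitor on the left factor alone, so the result is a pure tensor.\<close>
  also have "\<dots> = (?y \<cdot> inv (\<r> \<I>)) \<otimes> e"
    by (simp add: triangle_inv)
  finally have dy: "delta F \<cdot> ?y = (?y \<cdot> inv (\<r> \<I>)) \<otimes> e" .
  have "?y = (\<l> Q \<cdot> (eps F \<otimes> \<one> Q) \<cdot> delta F) \<cdot> ?y"
    by (simp add: D.delta_counit_left del: assoc_comp)
  also have "\<dots> = \<l> Q \<cdot> (eps F \<otimes> \<one> Q) \<cdot> (delta F \<cdot> ?y)" by simp
  also have "\<dots> = \<l> Q \<cdot> ((eps F \<cdot> mu F \<cdot> (\<psi> \<otimes> e) \<cdot> inv (\<r> \<I>)) \<otimes> e)"
    by (simp add: dy)
  finally show ?thesis .
qed

text \<open>The counit reaches one leg of the cup and leaves the unit on the other, which meets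
  \<open>\<psi>\<close> in \<open>c\<close>. The cap \<open>c\<close> is arbitrary, so cap and cup
  may come from different algebras, as in (\<open>\<alpha>\<close>).\<close>

lemma counit_bend:
  assumes F: "cfa V Q F" and c: "c \<in> hom V (Q \<odot> Q) \<I>" and p: "\<psi> \<in> hom V \<I> Q"
  shows "eps F \<cdot> bend V Q c (delta F \<cdot> eta F) \<cdot> \<psi> = c \<cdot> (\<psi> \<otimes> eta F) \<cdot> inv (\<r> \<I>)"
proof -
  interpret F: cfa V Q F by (rule F)
  interpret M: commutative_monoid V Q "mu F" "eta F" by (rule F.monoid)
  interpret D: cocommutative_comonoid V Q "delta F" "eps F" by (rule F.comonoid)
  note [simp] = F.obj
  have [simp]: "eta F \<in> arr V" "src V (eta F) = \<I>" "trg V (eta F) = Q"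
      "delta F \<in> arr V" "src V (delta F) = Q" "trg V (delta F) = Q \<odot> Q"
      "eps F \<in> arr V" "src V (eps F) = Q" "trg V (eps F) = \<I>"
      "c \<in> arr V" "src V c = Q \<odot> Q" "trg V c = \<I>" "\<psi> \<in> arr V" "src V \<psi> = \<I>" "trg V \<psi> = Q"
    using M.eta_hom D.delta_hom D.eps_hom c p by (auto simp: hom_def)
  let ?d = "delta F \<cdot> eta F" and ?r = "inv (\<r> \<I>)"
  have d: "(\<one> Q \<otimes> eps F) \<cdot> ?d = (eta F \<otimes> \<one> \<I>) \<cdot> ?r"
  proof (rule iso_cancel_left[where h = "\<r> Q"])
    have "\<r> Q \<cdot> (\<one> Q \<otimes> eps F) \<cdot> ?d = (\<r> Q \<cdot> (\<one> Q \<otimes> eps F) \<cdot> delta F) \<cdot> eta F"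
      by simp
    also have "\<dots> = eta F"
      by (simp add: D.delta_counit_right del: assoc_comp)
    also have "\<dots> = \<r> Q \<cdot> (eta F \<otimes> \<one> \<I>) \<cdot> ?r"
      using comp_reassoc[OF runit_nat[of "eta F" Q], of ?r] by simp
    finally show "\<r> Q \<cdot> (\<one> Q \<otimes> eps F) \<cdot> ?d = \<r> Q \<cdot> (eta F \<otimes> \<one> \<I>) \<cdot> ?r" .
  qed simp_all
  have "eps F \<cdot> bend V Q c ?d \<cdot> \<psi> =
    (eps F \<cdot> \<l> Q) \<cdot> (c \<otimes> \<one> Q) \<cdot> inv (\<a> Q Q Q) \<cdot> (\<one> Q \<otimes> ?d) \<cdot> (inv (\<r> Q) \<cdot> \<psi>)"
    by (simp add: bend_def)
  \<comment> \<open>Naturality of the unitors draws the counit and \<open>\<psi>\<close> into the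
    diagram, each tensored with an identity.\<close>
  also have "\<dots> = (\<l> \<I> \<cdot> (\<one> \<I> \<otimes> eps F)) \<cdot> (c \<otimes> \<one> Q) \<cdot> inv (\<a> Q Q Q) \<cdot> (\<psi> \<otimes> ?d) \<cdot> ?r"
    by (simp add: lunit_nat runit_inv_nat)
  \<comment> \<open>The cap and the counit act on disjoint factors, so the counit can be moved
    first, past the associator and onto the cup.\<close>
  also have "\<dots> = \<l> \<I> \<cdot> (c \<otimes> \<one> \<I>) \<cdot> ((\<one> Q \<otimes> \<one> Q) \<otimes> eps F) \<cdot> inv (\<a> Q Q Q) \<cdot> (\<psi> \<otimes> ?d) \<cdot> ?r"
    by simp
  also have "\<dots> = \<l> \<I> \<cdot> (c \<otimes> \<one> \<I>) \<cdot> inv (\<a> Q Q \<I>) \<cdot> (\<one> Q \<otimes> (\<one> Q \<otimes> eps F)) \<cdot> (\<psi> \<otimes> ?d) \<cdot> ?r"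
    using comp_reassoc[OF assoc_inv_nat[of "\<one> Q" "\<one> Q" "eps F" Q Q \<I>, symmetric], of "(\<psi> \<otimes> ?d) \<cdot> ?r"]
    by simp
  also have "\<dots> = \<l> \<I> \<cdot> (c \<otimes> \<one> \<I>) \<cdot> inv (\<a> Q Q \<I>) \<cdot> (\<psi> \<otimes> ((\<one> Q \<otimes> eps F) \<cdot> ?d)) \<cdot> ?r"
    by simp
  also have "\<dots> = \<l> \<I> \<cdot> (c \<otimes> \<one> \<I>) \<cdot> (inv (\<a> Q Q \<I>) \<cdot> (\<psi> \<otimes> (eta F \<otimes> \<one> \<I>))) \<cdot> (\<one> \<I> \<otimes> ?r) \<cdot> ?r"
    unfolding d by simp
  also have "\<dots> = \<l> \<I> \<cdot> (c \<otimes> \<one> \<I>) \<cdot> ((\<psi> \<otimes> eta F) \<otimes> \<one> \<I>) \<cdot> inv (\<a> \<I> \<I> \<I>) \<cdot> (\<one> \<I> \<otimes> ?r) \<cdot> ?r"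
    by (simp add: assoc_inv_nat)
  \<comment> \<open>The inverse triangle involves the left unitor at the unit object, whereas
    \<open>?r\<close> inverts the right one; the two unitors agree there.\<close>
  also have "\<dots> = \<l> \<I> \<cdot> ((c \<cdot> (\<psi> \<otimes> eta F)) \<otimes> \<one> \<I>) \<cdot> (?r \<otimes> \<one> \<I>) \<cdot> ?r"
    using comp_reassoc[OF triangle_inv[of \<I> \<I>], of ?r] by (simp add: lunit_unit_eq_runit_unit)
  also have "\<dots> = \<r> \<I> \<cdot> ((c \<cdot> (\<psi> \<otimes> eta F) \<cdot> ?r) \<otimes> \<one> \<I>) \<cdot> ?r"
    by (simp add: lunit_unit_eq_runit_unit)
  \<comment> \<open>Naturality of the right unitor at this scalar removes its extra unit
    factor.\<close>
  also have "\<dots> = c \<cdot> (\<psi> \<otimes> eta F) \<cdot> ?r"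
    using comp_reassoc[OF runit_nat[of "c \<cdot> (\<psi> \<otimes> eta F) \<cdot> ?r" \<I>], of ?r] by simp
  finally show ?thesis .
qed

text \<open>\<open>Phi\<close> inserts \<open>\<psi>\<close> on the right, while
  \<open>copyable_mult\<close> needs it on the left. Commutativity swaps the points, and the swap
  turns the inverse right unitor into the inverse left unitor found in \<open>scale\<close>.\<close>

lemma Phi_point:
  assumes F: "cfa V Q F" and e: "e \<in> hom V \<I> Q" and p: "\<psi> \<in> hom V \<I> Q"
  shows "Phi V Q F \<psi> \<cdot> e = mu F \<cdot> (\<psi> \<otimes> e) \<cdot> inv (\<l> \<I>)"
proof -
  interpret F: cfa V Q F by (rule F)
  interpret M: commutative_monoid V Q "mu F" "eta F" by (rule F.monoid)
  note [simp] = F.obj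
  have [simp]: "mu F \<in> arr V" "src V (mu F) = Q \<odot> Q" "trg V (mu F) = Q"
      "e \<in> arr V" "src V e = \<I>" "trg V e = Q" "\<psi> \<in> arr V" "src V \<psi> = \<I>" "trg V \<psi> = Q"
    using M.mu_hom e p by (auto simp: hom_def)
  have "Phi V Q F \<psi> \<cdot> e = mu F \<cdot> (e \<otimes> \<psi>) \<cdot> inv (\<r> \<I>)"
    by (simp add: Phi_def runit_inv_nat)
  also have "\<dots> = mu F \<cdot> (\<s> Q Q \<cdot> (e \<otimes> \<psi>)) \<cdot> inv (\<r> \<I>)"
    using comp_reassoc[OF M.mu_comm, of "(e \<otimes> \<psi>) \<cdot> inv (\<r> \<I>)"] by simp
  also have "\<dots> = mu F \<cdot> (\<psi> \<otimes> e) \<cdot> inv (\<l> \<I>)"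
    by (simp add: sym_nat sym_runit_inv)
  finally show ?thesis .
qed

end

theorem theorem3p2:
  fixes V :: "('o, 'm, 'x) symmetric_monoidal_category_scheme" (structure)
    and Q :: 'o and G W :: "'m frobenius"
  assumes "symmetric_monoidal_category V"
    and "ghz_w_pair V Q G W"
    and "plugging_set V Q {eta W, tau V Q G W \<cdot> eta W}"
  shows "\<forall>\<psi> \<in> hom V \<I> Q.
    Phi V Q G \<psi> \<cdot> eta W = scale V (eps W \<cdot> tau V Q G W \<cdot> \<psi>) (eta W)"
proof
  fix \<psi> assume p: "\<psi> \<in> hom V \<I> Q"
  interpret symmetric_monoidal_category V by (rule assms(1))
  interpret P: ghz_w_pair V Q G W by (rule assms(2))
  interpret G: ghz_structure V Q G by (rule P.ghz)
  interpret W: w_structure V Q W by (rule P.w)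
  interpret MG: commutative_monoid V Q "mu G" "eta G" by (rule G.monoid)
  interpret DG: cocommutative_comonoid V Q "delta G" "eps G" by (rule G.comonoid)
  interpret MW: commutative_monoid V Q "mu W" "eta W" by (rule W.monoid)
  note e = MW.eta_hom
  have [simp]: "mu G \<in> arr V" "src V (mu G) = Q \<odot> Q" "trg V (mu G) = Q"
      "eps G \<in> arr V" "src V (eps G) = Q" "trg V (eps G) = \<I>"
      "eta W \<in> arr V" "src V (eta W) = \<I>" "trg V (eta W) = Q"
      "\<psi> \<in> arr V" "src V \<psi> = \<I>" "trg V \<psi> = Q"
    using MG.mu_hom DG.eps_hom e p by (auto simp: hom_def)
  note [simp] = G.obj
  let ?s = "eps G \<cdot> mu G \<cdot> (\<psi> \<otimes> eta W) \<cdot> inv (\<r> \<I>)"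
  \<comment> \<open>After rewriting by (\<open>\<alpha>\<close>), \<open>counit_bend\<close> is
    applied to the W-structure with the GHZ cap as \<open>c\<close>.\<close>
  have "eps W \<cdot> tau V Q G W \<cdot> \<psi> = ?s"
    using counit_bend[OF W.cfa_axioms _ p, of "eps G \<cdot> mu G"] by (simp add: P.\<alpha> hom_def)
  moreover have "Phi V Q G \<psi> \<cdot> eta W = (mu G \<cdot> (\<psi> \<otimes> eta W)) \<cdot> inv (\<l> \<I>)"
    using Phi_point[OF G.cfa_axioms e p] by simp
  \<comment> \<open>Precomposing \<open>copyable_mult\<close> with the inverse left unitor gives
    exactly the unfolded form of \<open>scale\<close>.\<close>
  moreover have "\<dots> = \<l> Q \<cdot> (?s \<otimes> eta W) \<cdot> inv (\<l> \<I>)"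
    unfolding copyable_mult[OF G.cfa_axioms e P.\<beta> p] by simp
  ultimately show "Phi V Q G \<psi> \<cdot> eta W = scale V (eps W \<cdot> tau V Q G W \<cdot> \<psi>) (eta W)"
    by (simp add: scale_def)
qed

end
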